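(* Let $n\ge3$. Every iterated sequence $S$ for $\mathrm{Gr}(2,\mathbb C^n)$ corresponds to a path from $\mathtt T_3$ to $\mathtt T_n^S$ in the tree graph $\mathcal T$: the unlabeled trees underlying the associated tree sequence $(T_3^S,T_4^S,\dots,T_n^S)$ form a directed path $\mathtt T_3\to\mathtt T_4^S\to\dots\to\mathtt T_n^S$ in $\mathcal T$.
   Context: A trivalent tree is a tree all of whose internal (non-leaf) vertices have valency three. The tree graph $\mathcal T$ is the infinite directed graph whose vertices at level $i\ge3$ are the (unlabeled) trivalent trees with $i$ leaves (up to isomorphism); there is an arrow $\mathtt T\to\mathtt T'$ if $\mathtt T$ has $i$ leaves, $\mathtt T'$ has $i+1$ leaves and $\mathtt T'$ can be obtained from $\mathtt T$ by attaching a new boundary (leaf) edge to the middle of some edge of $\mathtt T$. Its unique source $\mathtt T_3$ is the trivalent tree with three leaves. An iterated sequence for $\mathrm{Gr}(2,\mathbb C^n)$ is a sequence of positive roots $S=(\varepsilon_{i_n}-\varepsilon_n,\varepsilon_{j_n}-\varepsilon_n,\dots,\varepsilon_{i_3}-\varepsilon_3,\varepsilon_{j_3}-\varepsilon_3)$ of type $\mathtt A_{n-1}$ with $i_l,j_l\in\{1,\dots,l-1\}$, $i_l\ne j_l$, for $3\le l\le n$. Its associated sequence of labeled trivalent trees is defined by: $T_3^S$ is the tree with one internal vertex and leaves labeled $1,2,3$; for $4\le l\le n$, $T_l^S$ is obtained from $T_{l-1}^S$ by replacing the edge with leaf $i_l$ by three edges forming a cherry (two leaf edges meeting in an internal vertex)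 with leaves labeled $i_l$ and $l$. $\mathtt T_l^S$ denotes the unlabeled tree underlying $T_l^S$. *)

theory Defs
  imports Complex_Main "Graph_Theory.Graph_Theory"
begin

text \<open>
  Undirected finite simple graphs are the symmetric loop-free digraphs of the locale
  \<open>pair_graph\<close>: every edge is a pair of opposite arcs, so the valency of a vertex is its
  out-degree. The library predicate \<open>tree\<close> cannot be used for them, because there the two arcs
  of an edge already count as a directed cycle; in a \<open>pair_graph\<close> the cycles of the underlying
  undirected graph are exactly the directed cycles of length at least 3.
\<close>

definition leaves :: "'a pair_pre_digraph \<Rightarrow> 'a set" where
  "leaves G = {v \<in> pverts G. out_degree (with_proj G) v = 1}"

definition undirected_tree :: "'a pair_pre_digraph \<Rightarrow> bool" where
  "undirected_tree G \<longleftrightarrow>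
     pair_graph G \<and> Digraph_Component.connected (with_proj G) \<and>
     \<not> (\<exists>p. pre_digraph.cycle (with_proj G) p \<and> 3 \<le> length p)"

definition trivalent_tree :: "'a pair_pre_digraph \<Rightarrow> bool" where
  "trivalent_tree G \<longleftrightarrow>
     undirected_tree G \<and> (\<forall>v \<in> pverts G - leaves G. out_degree (with_proj G) v = 3)"

text \<open>
  An unlabeled tree is an isomorphism class. Every finite graph has isomorphic copies with
  vertices in \<^typ>\<open>nat\<close>, so the class is represented by the set of all these copies; this makes
  classes of graphs over different vertex types comparable.
\<close>

definition unlabeled :: "'a pair_pre_digraph \<Rightarrow> nat pair_pre_digraph set" where
  "unlabeled G = {H. digraph_iso (with_proj G) (with_proj H)}"

definition tree_level :: "nat \<Rightarrow> nat pair_pre_digraph set set" where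
  "tree_level i = {unlabeled G | G :: nat pair_pre_digraph.
     trivalent_tree G \<and> card (leaves G) = i}"

text \<open>
  Attach to the middle \<open>w\<close> of the edge \<open>e\<close> a new edge ending in the leaf \<open>x\<close>
  (\<open>w\<close> and \<open>x\<close> are meant to be distinct and new).
\<close>

definition attach_leaf ::
    "'a pair_pre_digraph \<Rightarrow> 'a \<times> 'a \<Rightarrow> 'a \<Rightarrow> 'a \<Rightarrow> 'a pair_pre_digraph" where
  "attach_leaf G e w x =
     \<lparr> pverts = pverts (subdivide G e w) \<union> {x},
       parcs = parcs (subdivide G e w) \<union> {(w, x), (x, w)} \<rparr>"

definition tree_graph :: "nat pair_pre_digraph set pair_pre_digraph" where
  "tree_graph =
     \<lparr> pverts = (\<Union>i \<in> {3..}. tree_level i),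
       parcs = {(t, t'). \<exists>i \<ge> 3. t \<in> tree_level i \<and> t' \<in> tree_level (i + 1) \<and>
         (\<exists>G \<in> t. \<exists>e \<in> parcs G. \<exists>w x. w \<notin> pverts G \<and> x \<notin> pverts G \<and> w \<noteq> x \<and>
            attach_leaf G e w x \<in> t')} \<rparr>"

definition T3 :: "nat pair_pre_digraph set" where
  "T3 = unlabeled
     \<lparr> pverts = {0, 1, 2, 3 :: nat},
       parcs = {(0, 1), (1, 0), (0, 2), (2, 0), (0, 3), (3, 0)} \<rparr>"

text \<open>
  Type $A_{n-1}$ roots are realized in $\mathbb{R}^n$, as functions of the coordinate index that
  vanish outside \<open>{1..n}\<close>.
\<close>

definition eps :: "nat \<Rightarrow> nat \<Rightarrow> real" where
  "eps i = (\<lambda>k. if k = i then 1 else 0)"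

definition positive_roots_A :: "nat \<Rightarrow> (nat \<Rightarrow> real) set" where
  "positive_roots_A m = {eps i - eps j | i j. 1 \<le> i \<and> i < j \<and> j \<le> m + 1}"

definition iterated_sequence :: "nat \<Rightarrow> (nat \<Rightarrow> real) list \<Rightarrow> bool" where
  "iterated_sequence n S \<longleftrightarrow>
     set S \<subseteq> positive_roots_A (n - 1) \<and>
     (\<exists>i j. (\<forall>l \<in> {3..n}. i l \<in> {1..l - 1} \<and> j l \<in> {1..l - 1} \<and> i l \<noteq> j l) \<and>
        S = concat (map (\<lambda>l. [eps (i l) - eps l, eps (j l) - eps l]) (rev [3..<Suc n])))"

text \<open>
  The index $i_l$ is read off from the sequence: since $l$ descends from $n$ to $3$ in steps of two
  entries, $\varepsilon_{i_l} - \varepsilon_l$ is the entry at position $2(n-l)$, counted from $0$.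
\<close>

definition seq_index :: "nat \<Rightarrow> (nat \<Rightarrow> real) list \<Rightarrow> nat \<Rightarrow> nat" where
  "seq_index n S l = (THE i. i \<in> {1..l - 1} \<and> S ! (2 * (n - l)) = eps i - eps l)"

text \<open>
  In a labeled tree the leaf with label \<open>k\<close> is the vertex \<open>Leaf k\<close>. The names of the internal
  vertices carry no information; the one created together with leaf \<open>l\<close> is called \<open>Internal l\<close>.
\<close>

datatype node = Leaf nat | Internal nat

definition labeled_T3 :: "node pair_pre_digraph" where
  "labeled_T3 =
     \<lparr> pverts = {Internal 3, Leaf 1, Leaf 2, Leaf 3},
       parcs = (\<Union>k \<in> {1, 2, 3}. {(Internal 3, Leaf k), (Leaf k, Internal 3)}) \<rparr>"

text \<open>\<open>x\<close> below is the other end of the edge with leaf \<open>i\<close>.\<close>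

definition replace_by_cherry ::
    "node pair_pre_digraph \<Rightarrow> nat \<Rightarrow> nat \<Rightarrow> node pair_pre_digraph" where
  "replace_by_cherry G i l = (let x = (THE x. (x, Leaf i) \<in> parcs G) in
     \<lparr> pverts = pverts G \<union> {Internal l, Leaf l},
       parcs = (parcs G - {(x, Leaf i), (Leaf i, x)}) \<union>
         {(x, Internal l), (Internal l, x),
          (Internal l, Leaf i), (Leaf i, Internal l),
          (Internal l, Leaf l), (Leaf l, Internal l)} \<rparr>)"

text \<open>Only the values for \<open>3 \<le> l \<le> n\<close> are meaningful.\<close>

fun labeled_tree :: "nat \<Rightarrow> (nat \<Rightarrow> real) list \<Rightarrow> nat \<Rightarrow> node pair_pre_digraph" where
  "labeled_tree n S l =
     (if l \<le> 3 then labeled_T3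
      else replace_by_cherry (labeled_tree n S (l - 1)) (seq_index n S l) l)"

declare labeled_tree.simps [simp del]

end

theory Submission
  imports Defs
begin

text \<open>
  Replacing the leaf edge of \<open>i\<close> by a cherry with leaves \<open>i\<close> and \<open>l\<close> is the same as attaching the
  leaf \<open>l\<close> to the middle of that edge. Hence the step from $T_{l-1}^S$ to $T_l^S$ is an arrow of the
  tree graph as soon as its two ends are known to be trivalent trees with the right numbers of
  leaves.

  The latter is an induction on \<open>l\<close>, starting from the tree with three leaves. In the step the new
  middle vertex gets degree three, the new vertex is a leaf and all other degrees are kept.
  Connectedness survives because every walk can be detoured through the middle vertex. Acyclicity
  survives for a local reason: on a cycle of length at least three every vertex has two distinct
  neighbours that are on the cycle as well (\<open>cycle_two_neighbours\<close>). So the two leaves of the cherry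
  are on no such cycle, consequently neither is its middle vertex, and a cycle in the new tree would
  already be one in the old tree. This covers only leaf edges, which are the only edges that an
  iterated sequence ever subdivides (\<open>leaf_edge_attachment\<close>).

  Levels are defined through graphs on the natural numbers, whereas labeled trees have their own
  vertex type. The transfer rests on the fact that being a trivalent tree and the number of leaves
  are invariant under injective relabelling of the vertices. The same invariance shows that
  different levels are disjoint, so that the walk through the levels \<open>3, \<dots>, n\<close> visits no
  isomorphism class twice and is a path.
\<close>

section \<open>Symmetric loop-free graphs as relations\<close>

lemma pair_graph_iff:
  "pair_graph G \<longleftrightarrow> finite (pverts G) \<and> parcs G \<subseteq> pverts G \<times> pverts G \<and>
     sym (parcs G) \<and> (\<forall>v. (v, v) \<notin> parcs G)"
proof
  assume "pair_graph G"
  then interpret pair_graph G .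
  show "finite (pverts G) \<and> parcs G \<subseteq> pverts G \<times> pverts G \<and>
     sym (parcs G) \<and> (\<forall>v. (v, v) \<notin> parcs G)"
    using pair_finite_verts arc_fst_in_verts arc_snd_in_verts no_loops' arcs_symmetric
    by (force intro: symI)
next
  assume R: "finite (pverts G) \<and> parcs G \<subseteq> pverts G \<times> pverts G \<and>
     sym (parcs G) \<and> (\<forall>v. (v, v) \<notin> parcs G)"
  then have "finite (parcs G)"
    by (meson finite_SigmaI finite_subset)
  with R show "pair_graph G"
    by unfold_locales (auto simp: symmetric_def)
qed

lemma pair_graph_arc_sym: "pair_graph G \<Longrightarrow> (a, b) \<in> parcs G \<Longrightarrow> (b, a) \<in> parcs G"
  unfolding pair_graph_iff by (blast dest: symD)

text \<open>
  The symmetric closure in the definition of connectedness is the arc relation itself, and walks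
  cannot leave the vertex set.
\<close>

lemma connected_iff_rtrancl:
  assumes "pair_graph G"
  shows "Digraph_Component.connected (with_proj G) \<longleftrightarrow>
    pverts G \<noteq> {} \<and> (\<forall>u \<in> pverts G. \<forall>v \<in> pverts G. (u, v) \<in> (parcs G)\<^sup>*)"
proof -
  from assms have G: "parcs G \<subseteq> pverts G \<times> pverts G" "sym (parcs G)"
    by (auto simp: pair_graph_iff)
  then have "symcl (parcs G) = parcs G"
    by (auto simp: symcl_def dest: symD)
  moreover have "(u, v) \<in> rtrancl_on (pverts G) (parcs G) \<longleftrightarrow> (u, v) \<in> (parcs G)\<^sup>*"
    if "u \<in> pverts G" "v \<in> pverts G" for u v
    using that G(1) by (auto intro: rtrancl_on_rtranclI rtrancl_consistent_rtrancl_on)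
  ultimately show ?thesis
    by (simp add: connected_conv)
qed

lemma pawalk_verts_eq_map_snd: "pcas u p v \<Longrightarrow> pawalk_verts u p = u # map snd p"
  by (induction u p v rule: pcas.induct) auto

text \<open>
  This form mentions only arcs, so that a cycle can be moved to another graph that contains its arcs.
\<close>

lemma cycle_iff_pcas:
  assumes "pair_graph G"
  shows "pre_digraph.cycle (with_proj G) p \<longleftrightarrow>
    p \<noteq> [] \<and> set p \<subseteq> parcs G \<and> pcas (fst (hd p)) p (fst (hd p)) \<and> distinct (map snd p)"
proof -
  have cycle: "pre_digraph.cycle (with_proj G) p \<longleftrightarrow>
      (\<exists>u. u \<in> pverts G \<and> set p \<subseteq> parcs G \<and> pcas u p u \<and> distinct (tl (pawalk_verts u p)) \<and> p \<noteq> [])"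
    by (simp only: pre_digraph.cycle_def pre_digraph.awalk_def cas_with_proj_eq
        awalk_verts_with_proj_eq with_proj_simps conj_assoc)
  have tl: "tl (pawalk_verts u p) = map snd p" if "pcas u p u" for u
    using that by (simp add: pawalk_verts_eq_map_snd)
  have start: "u = fst (hd p)" if "pcas u p u" "p \<noteq> []" for u
    using that by (cases p) simp_all
  have verts: "fst (hd p) \<in> pverts G" if "set p \<subseteq> parcs G" "p \<noteq> []"
  proof -
    have "hd p \<in> pverts G \<times> pverts G"
      using that assms hd_in_set[of p] unfolding pair_graph_iff by blast
    then show ?thesis
      by (simp add: mem_Times_iff)
  qed
  show ?thesis
    unfolding cycle using tl start verts by metis
qed

lemma out_degree_eq_card_Image: "out_degree (with_proj G) v = card (parcs G `` {v})"
proof -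
  have "out_arcs (with_proj G) v = Pair v ` (parcs G `` {v})"
    by (auto simp: out_arcs_def)
  then show ?thesis
    by (simp add: out_degree_def card_image inj_on_def)
qed

section \<open>Leaves do not lie on cycles\<close>

lemma pcas_append: "pcas u (p @ q) v \<longleftrightarrow> (\<exists>w. pcas u p w \<and> pcas w q v)"
  by (induction p arbitrary: u) auto

text \<open>
  Read the closed walk from the arc that leaves \<open>v\<close>: it ends with two arcs \<open>d\<close> and \<open>e\<close>, the latter
  entering \<open>v\<close>. The predecessor of \<open>v\<close> is the head of \<open>d\<close>, and it differs from the successor \<open>b\<close>
  because the arcs of the walk have distinct heads. Length at least three is what separates \<open>d\<close> from
  the arc that leaves \<open>v\<close>.
\<close>

lemma closed_walk_two_neighbours:
  assumes "pcas u p u" "distinct (map snd p)" "3 \<le> length p" "v \<in> fst ` set p"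
  obtains a b where "a \<noteq> b" "(a, v) \<in> set p" "(v, b) \<in> set p"
proof -
  from assms(4) obtain b where "(v, b) \<in> set p"
    by force
  then obtain p1 p2 where p: "p = p1 @ (v, b) # p2"
    by (auto simp: in_set_conv_decomp)
  define q where "q = p2 @ p1"
  from assms(1) p have q: "pcas b q v"
    by (auto simp: q_def pcas_append)
  from assms(3) p have "2 \<le> length q"
    by (simp add: q_def)
  then obtain r d e where qr: "q = r @ [d, e]"
  proof (cases q rule: rev_cases)
    case (snoc q' e)
    with \<open>2 \<le> length q\<close> that show thesis
      by (cases q' rule: rev_cases) auto
  qed simp
  with q have "snd e = v" "fst e = snd d"
    by (auto simp: pcas_append)
  moreover have "snd d \<noteq> b"
  proof -
    have "d \<in> set (p2 @ p1)"
      using qr by (simp add: q_def)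
    with assms(2) p show ?thesis
      by auto
  qed
  moreover have "set q \<subseteq> set p"
    by (auto simp: p q_def)
  moreover have "e \<in> set q"
    by (simp add: qr)
  ultimately have "fst e \<noteq> b" "(fst e, v) \<in> set p"
    using prod.collapse[of e] by auto
  with \<open>(v, b) \<in> set p\<close> show thesis
    by (intro that)
qed

lemma closed_walk_heads:
  assumes "pcas u p u"
  shows "snd ` set p \<subseteq> fst ` set p"
proof -
  have "snd ` set q \<subseteq> insert w (fst ` set q)" if "pcas v q w" for q :: "('a \<times> 'a) list" and v w
    using that
  proof (induction v q w rule: pcas.induct)
    case (2 u e es v)
    then show ?case by (cases es) auto
  qed simp
  from this[OF assms] assms show ?thesis
    by (cases p) auto
qed

lemma cycle_two_neighbours:
  assumes "pair_graph G" "pre_digraph.cycle (with_proj G) p" "3 \<le> length p" "v \<in> fst ` set p"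
  obtains a b where "a \<noteq> b" "a \<in> fst ` set p" "b \<in> fst ` set p" "(v, a) \<in> parcs G" "(v, b) \<in> parcs G"
proof -
  have p: "set p \<subseteq> parcs G" "pcas (fst (hd p)) p (fst (hd p))" "distinct (map snd p)"
    using assms(1,2) by (simp_all add: cycle_iff_pcas)
  obtain a b where ab: "a \<noteq> b" "(a, v) \<in> set p" "(v, b) \<in> set p"
    using closed_walk_two_neighbours[OF p(2,3) assms(3,4)] .
  have "a \<in> fst ` set p"
    using imageI[OF ab(2), of fst] by simp
  moreover have "b \<in> fst ` set p"
    using subsetD[OF closed_walk_heads[OF p(2)] imageI[OF ab(3), of snd]] by simp
  moreover have "(v, a) \<in> parcs G"
    by (rule pair_graph_arc_sym[OF assms(1) subsetD[OF p(1) ab(2)]])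
  moreover have "(v, b) \<in> parcs G"
    using ab(3) p(1) by (rule subsetD[rotated])
  ultimately show thesis
    by (rule that[OF ab(1)])
qed

text \<open>
  Only neighbours on the cycle are restricted. Hence vertices can be excluded successively: once the
  leaves at an inner vertex are known to be off the cycle, the vertex itself may have only one
  candidate neighbour left.
\<close>

lemma single_neighbour_not_on_cycle:
  assumes "pair_graph G" "pre_digraph.cycle (with_proj G) p" "3 \<le> length p"
    and "\<And>b. (v, b) \<in> parcs G \<Longrightarrow> b \<in> fst ` set p \<Longrightarrow> b = c"
  shows "v \<notin> fst ` set p"
proof
  assume "v \<in> fst ` set p"
  with assms(1-3) obtain a b where "a \<noteq> b" "a \<in> fst ` set p" "b \<in> fst ` set p"
    "(v, a) \<in> parcs G" "(v, b) \<in> parcs G"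
    by (rule cycle_two_neighbours)
  with assms(4)[of a] assms(4)[of b] show False
    by simp
qed

section \<open>Relabelling vertices\<close>

definition relabel :: "('a \<Rightarrow> 'b) \<Rightarrow> 'a pair_pre_digraph \<Rightarrow> 'b pair_pre_digraph" where
  "relabel f G = \<lparr>pverts = f ` pverts G, parcs = map_prod f f ` parcs G\<rparr>"

lemma relabel_simps [simp]:
  "pverts (relabel f G) = f ` pverts G"
  "parcs (relabel f G) = map_prod f f ` parcs G"
  by (simp_all add: relabel_def)

text \<open>
  A library isomorphism carries a separate map on arcs and new end maps. Between graphs whose arcs
  are pairs the end maps are the projections, so the vertex map determines the arc map.
\<close>

lemma digraph_iso_iff_relabel:
  assumes "pair_graph G"
  shows "digraph_iso (with_proj G) (with_proj H) \<longleftrightarrow>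
    (\<exists>f. inj_on f (pverts G) \<and> H = relabel f G)"
proof
  assume "digraph_iso (with_proj G) (with_proj H)"
  then obtain h where h: "pre_digraph.digraph_isomorphism (with_proj G) h"
    and H: "with_proj H = app_iso h (with_proj G)"
    by (auto simp: digraph_iso_def)
  from H have ends: "iso_tail h = fst" "iso_head h = snd"
    by (simp_all add: with_proj_def app_iso_def)
  with h have "iso_arcs h e = map_prod (iso_verts h) (iso_verts h) e" if "e \<in> parcs G" for e
    using that by (auto simp: pre_digraph.digraph_isomorphism_def prod_eq_iff)
  then have "iso_arcs h ` parcs G = map_prod (iso_verts h) (iso_verts h) ` parcs G"
    by (rule image_cong[OF refl])
  with H have "H = relabel (iso_verts h) G"
    by (simp add: with_proj_def app_iso_def relabel_def)
  with h show "\<exists>f. inj_on f (pverts G) \<and> H = relabel f G"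
    by (auto simp: pre_digraph.digraph_isomorphism_def)
next
  assume "\<exists>f. inj_on f (pverts G) \<and> H = relabel f G"
  then obtain f where f: "inj_on f (pverts G)" and H: "H = relabel f G"
    by blast
  define h where "h = \<lparr>iso_verts = f, iso_arcs = map_prod f f, iso_head = snd, iso_tail = fst\<rparr>"
  interpret pair_graph G by fact
  have "inj_on (map_prod f f) (parcs G)"
    using f assms by (auto simp: pair_graph_iff intro: inj_on_subset[OF map_prod_inj_on])
  then have "digraph_isomorphism h"
    using f wf_digraph by (simp add: digraph_isomorphism_def h_def)
  moreover have "with_proj H = app_iso h (with_proj G)"
    by (simp add: H h_def with_proj_def app_iso_def relabel_def)
  ultimately show "digraph_iso (with_proj G) (with_proj H)"
    by (auto simp: digraph_iso_def)
qed

lemma relabel_in_unlabeled: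
  "pair_graph G \<Longrightarrow> inj_on f (pverts G) \<Longrightarrow> relabel f G \<in> unlabeled G"
  by (auto simp: unlabeled_def digraph_iso_iff_relabel)

lemma unlabeled_relabel:
  assumes "pair_graph G" "inj_on f (pverts G)"
  shows "unlabeled (relabel f G) = unlabeled G"
proof -
  interpret pair_graph G by fact
  have "digraph_iso (with_proj G) (with_proj (relabel f G))"
    using assms by (auto simp: digraph_iso_iff_relabel)
  moreover from this have "digraph_iso (with_proj (relabel f G)) (with_proj G)"
    by (rule digraph_iso_swap[OF wf_digraph])
  ultimately show ?thesis
    by (auto simp: unlabeled_def intro: digraph_iso_trans)
qed

lemma pair_graph_relabel:
  assumes "pair_graph G" "inj_on f (pverts G)"
  shows "pair_graph (relabel f G)"
  using assms unfolding pair_graph_iff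
  by (auto simp: sym_def dest: inj_onD)

lemma Image_relabel:
  assumes "pair_graph G" "inj_on f (pverts G)" "v \<in> pverts G"
  shows "parcs (relabel f G) `` {f v} = f ` (parcs G `` {v})"
  using assms by (force simp: pair_graph_iff dest: inj_onD)

lemma out_degree_relabel:
  assumes "pair_graph G" "inj_on f (pverts G)" "v \<in> pverts G"
  shows "out_degree (with_proj (relabel f G)) (f v) = out_degree (with_proj G) v"
proof -
  have "parcs G `` {v} \<subseteq> pverts G"
    using assms(1) by (auto simp: pair_graph_iff)
  then show ?thesis
    using assms by (simp only: out_degree_eq_card_Image Image_relabel)
      (meson card_image inj_on_subset)
qed

lemma leaves_relabel:
  assumes "pair_graph G" "inj_on f (pverts G)"
  shows "leaves (relabel f G) = f ` leaves G"
  using out_degree_relabel[OF assms] by (auto simp: leaves_def)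

lemma card_leaves_relabel:
  assumes "pair_graph G" "inj_on f (pverts G)"
  shows "card (leaves (relabel f G)) = card (leaves G)"
proof -
  have "inj_on f (leaves G)"
    using assms(2) by (rule inj_on_subset) (auto simp: leaves_def)
  then show ?thesis
    by (simp add: leaves_relabel[OF assms] card_image)
qed

text \<open>Injectivity is what allows a walk in the image to be pulled back: consecutive arcs that meet in
  the image already meet in the original graph.\<close>

lemma pcas_map_inj:
  assumes "inj_on f V" "set q \<subseteq> V \<times> V" "u \<in> V" "v \<in> V"
    and "pcas (f u) (map (map_prod f f) q) (f v)"
  shows "pcas u q v"
  using assms(2-) by (induction q arbitrary: u) (auto dest: inj_onD[OF assms(1)])

lemma undirected_tree_relabel:
  assumes "undirected_tree G" "inj_on f (pverts G)"
  shows "undirected_tree (relabel f G)"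
proof -
  have G: "pair_graph G" and con: "Digraph_Component.connected (with_proj G)"
    and acyclic: "\<And>q. pre_digraph.cycle (with_proj G) q \<Longrightarrow> \<not> 3 \<le> length q"
    using assms(1) by (auto simp: undirected_tree_def)
  note H = pair_graph_relabel[OF G assms(2)]
  have "(f u, f v) \<in> (parcs (relabel f G))\<^sup>*" if "(u, v) \<in> (parcs G)\<^sup>*" for u v
    using that by induction (force intro: rtrancl_into_rtrancl)+
  with con have "Digraph_Component.connected (with_proj (relabel f G))"
    by (simp add: connected_iff_rtrancl G H)
  moreover have False
    if p: "pre_digraph.cycle (with_proj (relabel f G)) p" "3 \<le> length p" for p
  proof -
    from p(1) have "set p \<subseteq> map_prod f f ` parcs G"
      by (simp add: cycle_iff_pcas H)
    then have "p \<in> map (map_prod f f) ` lists (parcs G)"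
      by (simp only: lists_image[symmetric] in_lists_conv_set) blast
    then obtain q where q: "p = map (map_prod f f) q" "set q \<subseteq> parcs G"
      by auto
    moreover have "set q \<subseteq> pverts G \<times> pverts G"
      using q(2) G by (auto simp: pair_graph_iff)
    moreover have "q \<noteq> []"
      using p(2) q(1) by auto
    moreover from calculation have "fst (hd q) \<in> pverts G"
      by (cases q) auto
    moreover have "pcas (f (fst (hd q))) (map (map_prod f f) q) (f (fst (hd q)))"
      using p(1) \<open>q \<noteq> []\<close> by (simp add: cycle_iff_pcas H q(1) hd_map)
    ultimately have "pcas (fst (hd q)) q (fst (hd q))"
      using pcas_map_inj[OF assms(2)] by metis
    moreover have "distinct (map snd q)"
    proof -
      have "distinct (map f (map snd q))"
        using p(1) by (simp add: cycle_iff_pcas H q(1) comp_def)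
      then show ?thesis
        unfolding distinct_map by blast
    qed
    ultimately have "pre_digraph.cycle (with_proj G) q"
      using q(2) \<open>q \<noteq> []\<close> by (simp add: cycle_iff_pcas G)
    with acyclic[of q] p(2) q(1) show False
      by simp
  qed
  ultimately show ?thesis
    using H by (auto simp: undirected_tree_def)
qed

lemma trivalent_tree_relabel:
  assumes "trivalent_tree G" "inj_on f (pverts G)"
  shows "trivalent_tree (relabel f G)"
proof -
  have G: "pair_graph G"
    using assms(1) by (simp add: trivalent_tree_def undirected_tree_def)
  have "out_degree (with_proj (relabel f G)) v' = 3"
    if v': "v' \<in> pverts (relabel f G) - leaves (relabel f G)" for v'
  proof -
    obtain v where v: "v' = f v" "v \<in> pverts G"
      using v' by auto
    with v' have "v \<in> pverts G - leaves G"
      by (simp add: leaves_relabel[OF G assms(2)]) blast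
    with v assms(1) show ?thesis
      by (simp add: out_degree_relabel[OF G assms(2)] trivalent_tree_def)
  qed
  moreover have "undirected_tree (relabel f G)"
    using assms(1) by (intro undirected_tree_relabel assms(2)) (simp add: trivalent_tree_def)
  ultimately show ?thesis
    unfolding trivalent_tree_def by (intro conjI ballI)
qed

section \<open>Attaching a leaf to a leaf edge\<close>

lemma attach_leaf_simps [simp]:
  "pverts (attach_leaf G e w z) = pverts G \<union> {w, z}"
  "parcs (attach_leaf G (x, y) w z) =
    parcs G - {(x, y), (y, x)} \<union> {(x, w), (w, x), (w, y), (y, w), (w, z), (z, w)}"
  by (auto simp: attach_leaf_def)

lemma relabel_attach_leaf:
  assumes "inj f"
  shows "relabel f (attach_leaf G (x, y) w z) = attach_leaf (relabel f G) (f x, f y) (f w) (f z)"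
  using assms
  by (simp add: relabel_def attach_leaf_def image_Un image_set_diff prod.inj_map insert_commute)

text \<open>
  The edge to be subdivided joins the leaf \<open>y\<close> to its only neighbour \<open>x\<close>; afterwards \<open>w\<close> is the
  middle of the cherry with leaves \<open>y\<close> and \<open>z\<close>.
\<close>

locale leaf_edge_attachment =
  fixes G :: "'a pair_pre_digraph" and x y w z :: 'a
  assumes trivalent: "trivalent_tree G"
    and neighbour_y: "parcs G `` {y} = {x}"
    and new: "w \<notin> pverts G" "z \<notin> pverts G" "w \<noteq> z"
begin

abbreviation "G' \<equiv> attach_leaf G (x, y) w z"

lemma G: "pair_graph G"
  using trivalent by (simp add: trivalent_tree_def undirected_tree_def)

lemma xy: "(x, y) \<in> parcs G" "(y, x) \<in> parcs G" "x \<noteq> y" "x \<in> pverts G" "y \<in> pverts G"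
  and new_not_in_parcs:
    "(w, v) \<notin> parcs G" "(z, v) \<notin> parcs G" "(v, w) \<notin> parcs G" "(v, z) \<notin> parcs G"
    "w \<noteq> x" "w \<noteq> y" "z \<noteq> x" "z \<noteq> y"
proof -
  show yx: "(y, x) \<in> parcs G"
    using neighbour_y by blast
  then show "(x, y) \<in> parcs G"
    by (rule pair_graph_arc_sym[OF G])
  from yx show "x \<noteq> y" "x \<in> pverts G" "y \<in> pverts G"
    using G by (auto simp: pair_graph_iff)
  then show "(w, v) \<notin> parcs G" "(z, v) \<notin> parcs G" "(v, w) \<notin> parcs G" "(v, z) \<notin> parcs G"
    "w \<noteq> x" "w \<noteq> y" "z \<noteq> x" "z \<noteq> y"
    using G new by (auto simp: pair_graph_iff)
qed

lemma arc_y_iff: "(y, v) \<in> parcs G \<longleftrightarrow> v = x"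
  using neighbour_y by blast

lemma arcs_attach_iff:
  "(w, v) \<in> parcs G' \<longleftrightarrow> v = x \<or> v = y \<or> v = z"
  "(y, v) \<in> parcs G' \<longleftrightarrow> v = w"
  "(z, v) \<in> parcs G' \<longleftrightarrow> v = w"
  "(x, v) \<in> parcs G' \<longleftrightarrow> v = w \<or> ((x, v) \<in> parcs G \<and> v \<noteq> y)"
  "u \<notin> {w, x, y, z} \<Longrightarrow> (u, v) \<in> parcs G' \<longleftrightarrow> (u, v) \<in> parcs G"
  using xy(3) xy(3)[symmetric] new(3) new(3)[symmetric]
    new_not_in_parcs(5-8) new_not_in_parcs(5-8)[symmetric]
  by (simp_all add: arc_y_iff new_not_in_parcs(1,2))

lemma pair_graph_attach: "pair_graph G'"
  unfolding pair_graph_iff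
proof (intro conjI)
  have fin: "finite (pverts G)" and sub: "parcs G \<subseteq> pverts G \<times> pverts G"
    and irrefl: "\<And>v. (v, v) \<notin> parcs G"
    using G by (simp_all add: pair_graph_iff)
  show "finite (pverts G')"
    using fin by simp
  show "parcs G' \<subseteq> pverts G' \<times> pverts G'"
  proof (rule subrelI)
    fix a b assume "(a, b) \<in> parcs G'"
    then show "(a, b) \<in> pverts G' \<times> pverts G'"
      using subsetD[OF sub, of "(a, b)"] xy(4,5)
      by (simp only: attach_leaf_simps Un_iff Diff_iff insert_iff empty_iff prod.inject mem_Sigma_iff) blast
  qed
  show "\<forall>v. (v, v) \<notin> parcs G'"
    using irrefl new_not_in_parcs(5,6) new(3) by simp
  show "sym (parcs G')"
  proof (rule symI)
    fix a b assume "(a, b) \<in> parcs G'"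
    then show "(b, a) \<in> parcs G'"
      using pair_graph_arc_sym[OF G, of a b]
      by (simp only: attach_leaf_simps Un_iff Diff_iff insert_iff empty_iff prod.inject) blast
  qed
qed

text \<open>
  Every vertex stays reachable from \<open>x\<close> along the old walk: the removed arc to \<open>y\<close> is replaced by the
  detour over \<open>w\<close>, and the removed arc from \<open>y\<close> only leads back to the start.
\<close>

lemma connected_attach: "Digraph_Component.connected (with_proj G')"
proof -
  have "Digraph_Component.connected (with_proj G)"
    using trivalent by (simp add: trivalent_tree_def undirected_tree_def)
  then have con: "(x, v) \<in> (parcs G)\<^sup>*" if "v \<in> pverts G" for v
    using that xy by (auto simp: connected_iff_rtrancl G)
  have w: "(x, w) \<in> (parcs G')\<^sup>*"
    by auto
  have y: "(x, y) \<in> (parcs G')\<^sup>*"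
    by (rule rtrancl_into_rtrancl[OF w]) simp
  have z: "(x, z) \<in> (parcs G')\<^sup>*"
    by (rule rtrancl_into_rtrancl[OF w]) simp
  have "(x, v) \<in> (parcs G')\<^sup>*" if "(x, v) \<in> (parcs G)\<^sup>*" for v
    using that
  proof induction
    case (step v v')
    show ?case
    proof (cases "(v, v') \<in> {(x, y), (y, x)}")
      case True
      with y show ?thesis by auto
    next
      case False
      with step(2) have "(v, v') \<in> parcs G'"
        by auto
      with step(3) show ?thesis
        by (rule rtrancl_into_rtrancl)
    qed
  qed simp
  with con w z have reach: "(x, v) \<in> (parcs G')\<^sup>*" if "v \<in> pverts G'" for v
    using that by auto
  have "sym ((parcs G')\<^sup>*)"
    using pair_graph_attach unfolding pair_graph_iff by (intro sym_rtrancl) simp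
  with reach have "(u, v) \<in> (parcs G')\<^sup>*" if "u \<in> pverts G'" "v \<in> pverts G'" for u v
    using that by (meson rtrancl_trans symD)
  then show ?thesis
    unfolding connected_iff_rtrancl[OF pair_graph_attach] by auto
qed

text \<open>
  The leaves \<open>z\<close> and \<open>y\<close> have \<open>w\<close> as their only neighbour, so they are off the cycle. This leaves
  \<open>x\<close> as the only possible neighbour of \<open>w\<close> on the cycle, so \<open>w\<close> is off the cycle too. All
  remaining arcs belong to the old tree.
\<close>

lemma acyclic_attach:
  assumes p: "pre_digraph.cycle (with_proj G') p" "3 \<le> length p"
  shows False
proof -
  define V where "V = fst ` set p"
  have arcs: "set p \<subseteq> parcs G'" and closed: "pcas (fst (hd p)) p (fst (hd p))"
    and rest: "p \<noteq> []" "distinct (map snd p)"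
    using p(1) by (simp_all only: cycle_iff_pcas[OF pair_graph_attach] simp_thms)
  note off_cycle = single_neighbour_not_on_cycle[OF pair_graph_attach p, folded V_def]
  \<comment> \<open>Each exclusion names the only neighbour that could still lie on the cycle.\<close>
  have z: "z \<notin> V"
    by (rule off_cycle[where c = w]) (simp only: arcs_attach_iff)
  have y: "y \<notin> V"
    by (rule off_cycle[where c = w]) (simp only: arcs_attach_iff)
  have w: "w \<notin> V"
    by (rule off_cycle[where c = x]) (use y z in \<open>auto simp only: arcs_attach_iff\<close>)
  have "set p \<subseteq> parcs G"
  proof (rule subrelI)
    fix a b assume ab: "(a, b) \<in> set p"
    then have "(a, b) \<in> parcs G'"
      using arcs by (rule subsetD[rotated])
    moreover have "a \<in> V"
      using imageI[OF ab, of fst] by (simp add: V_def)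
    moreover have "b \<in> V"
      using subsetD[OF closed_walk_heads[OF closed] imageI[OF ab, of snd]] by (simp add: V_def)
    ultimately show "(a, b) \<in> parcs G"
      using w y z arcs_attach_iff(4)[of b] arcs_attach_iff(5)[of a b] by (cases "a = x") auto
  qed
  then have "pre_digraph.cycle (with_proj G) p"
    using closed rest by (simp only: cycle_iff_pcas[OF G] simp_thms)
  moreover have "\<not> (\<exists>p. pre_digraph.cycle (with_proj G) p \<and> 3 \<le> length p)"
    using trivalent by (simp only: trivalent_tree_def undirected_tree_def simp_thms)
  ultimately show False
    using p(2) by blast
qed

lemma Image_attach:
  "parcs G' `` {w} = {x, y, z}"
  "parcs G' `` {y} = {w}"
  "parcs G' `` {z} = {w}"
  "parcs G' `` {x} = insert w (parcs G `` {x} - {y})"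
  "v \<notin> {w, x, y, z} \<Longrightarrow> parcs G' `` {v} = parcs G `` {v}"
  by (simp_all only: set_eq_iff Image_singleton_iff arcs_attach_iff insert_iff empty_iff
      Diff_iff simp_thms)

text \<open>
  For \<open>x\<close> the neighbour \<open>y\<close> is exchanged for \<open>w\<close>, and for \<open>y\<close> the neighbour \<open>x\<close> is.
\<close>

lemma out_degree_attach:
  "out_degree (with_proj G') w = 3"
  "out_degree (with_proj G') z = 1"
  "v \<in> pverts G \<Longrightarrow> out_degree (with_proj G') v = out_degree (with_proj G) v"
proof -
  show "out_degree (with_proj G') w = 3" "out_degree (with_proj G') z = 1"
    using xy new_not_in_parcs by (simp_all add: out_degree_eq_card_Image Image_attach del: attach_leaf_simps)
  have fin: "finite (parcs G `` {x})"
    using G finite_subset[of "parcs G `` {x}" "pverts G"] by (auto simp: pair_graph_iff)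
  show "out_degree (with_proj G') v = out_degree (with_proj G) v" if v: "v \<in> pverts G"
  proof (cases "v = x")
    case True
    have "card (insert w (parcs G `` {x} - {y})) = Suc (card (parcs G `` {x} - {y}))"
      using fin new_not_in_parcs(3) by (intro card_insert_disjoint) auto
    also have "\<dots> = card (parcs G `` {x})"
      using xy(1) by (intro card_Suc_Diff1[OF fin]) simp
    finally have "card (insert w (parcs G `` {x} - {y})) = card (parcs G `` {x})" .
    with True show ?thesis
      by (simp add: out_degree_eq_card_Image Image_attach del: attach_leaf_simps)
  next
    case False
    show ?thesis
    proof (cases "v = y")
      case True
      then show ?thesis
        by (simp only: out_degree_eq_card_Image Image_attach neighbour_y) simp
    next
      case False
      with \<open>v \<noteq> x\<close> v new have "v \<notin> {w, x, y, z}"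
        by blast
      from Image_attach(5)[OF this] show ?thesis
        by (simp only: out_degree_eq_card_Image)
    qed
  qed
qed

lemma leaves_attach: "leaves G' = insert z (leaves G)"
  using out_degree_attach by (auto simp: leaves_def)

lemma trivalent_tree_attach: "trivalent_tree G'"
  unfolding trivalent_tree_def undirected_tree_def
proof (intro conjI ballI)
  fix v assume "v \<in> pverts G' - leaves G'"
  then have "v = w \<or> v \<in> pverts G - leaves G"
    unfolding leaves_attach attach_leaf_simps by blast
  moreover have "out_degree (with_proj G) v = 3" if "v \<in> pverts G - leaves G"
    using that trivalent unfolding trivalent_tree_def by blast
  ultimately show "out_degree (with_proj G') v = 3"
    by (metis out_degree_attach(1,3) DiffD1)
next
  show "\<not> (\<exists>p. pre_digraph.cycle (with_proj G') p \<and> 3 \<le> length p)"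
    by (blast dest: acyclic_attach)
qed (rule pair_graph_attach connected_attach)+

end

section \<open>Levels of the tree graph\<close>

text \<open>Two representatives of the same class are isomorphic, hence have equally many leaves.\<close>

lemma tree_level_unique:
  assumes "t \<in> tree_level i" "t \<in> tree_level j"
  shows "i = j"
proof -
  obtain G :: "nat pair_pre_digraph" where G: "t = unlabeled G" "trivalent_tree G" "card (leaves G) = i"
    using assms(1) by (auto simp: tree_level_def)
  obtain H :: "nat pair_pre_digraph" where H: "t = unlabeled H" "trivalent_tree H" "card (leaves H) = j"
    using assms(2) by (auto simp: tree_level_def)
  have graphs: "pair_graph G" "pair_graph H"
    using G(2) H(2) by (auto simp: trivalent_tree_def undirected_tree_def)
  have "relabel id H \<in> unlabeled G"
    using relabel_in_unlabeled[of H id] graphs G(1) H(1) by simp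
  moreover have "relabel id H = H"
    by (simp add: relabel_def prod.map_id0)
  ultimately have "digraph_iso (with_proj G) (with_proj H)"
    by (simp add: unlabeled_def)
  then show ?thesis
    using G(3) H(3) graphs by (auto simp: digraph_iso_iff_relabel card_leaves_relabel)
qed

text \<open>
  A single injection on all nodes, rather than one for each tree, makes relabelling commute with
  attaching leaves; even and odd numbers keep the two kinds of nodes apart.
\<close>

fun node_code :: "node \<Rightarrow> nat" where
  "node_code (Leaf k) = 2 * k"
| "node_code (Internal k) = 2 * k + 1"

lemma inj_node_code: "inj node_code"
proof (rule injI)
  fix a b assume "node_code a = node_code b"
  then show "a = b"
    by (cases a; cases b) (simp_all, presburger+)
qed

lemma unlabeled_in_tree_level:
  fixes G :: "node pair_pre_digraph"
  assumes "trivalent_tree G" "card (leaves G) = i"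
  shows "unlabeled G \<in> tree_level i"
proof -
  have inj: "inj_on node_code (pverts G)"
    using inj_node_code by (rule inj_on_subset) simp
  have G: "pair_graph G"
    using assms(1) by (simp add: trivalent_tree_def undirected_tree_def)
  have "unlabeled G = unlabeled (relabel node_code G)"
    by (simp add: unlabeled_relabel[OF G inj])
  with assms show ?thesis
    using trivalent_tree_relabel[OF assms(1) inj] card_leaves_relabel[OF G inj]
    unfolding tree_level_def by blast
qed

lemma tree_graph_arcI:
  assumes "t \<in> tree_level i" "t' \<in> tree_level (i + 1)" "3 \<le> i"
    and "G \<in> t" "e \<in> parcs G" "w \<notin> pverts G" "z \<notin> pverts G" "w \<noteq> z"
    and "attach_leaf G e w z \<in> t'"
  shows "(t, t') \<in> parcs tree_graph"
  unfolding tree_graph_def pair_pre_digraph.simps mem_Collect_eq case_prod_conv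
  using assms by blast

lemma attach_leaf_tree_graph_arc:
  fixes G :: "node pair_pre_digraph"
  assumes "trivalent_tree G" "trivalent_tree (attach_leaf G (x, y) w z)"
    and "card (leaves G) = i" "card (leaves (attach_leaf G (x, y) w z)) = i + 1" "3 \<le> i"
    and "(x, y) \<in> parcs G" "w \<notin> pverts G" "z \<notin> pverts G" "w \<noteq> z"
  shows "(unlabeled G, unlabeled (attach_leaf G (x, y) w z)) \<in> parcs tree_graph"
proof -
  let ?f = node_code
  have inj: "inj_on ?f V" for V
    using inj_node_code by (rule inj_on_subset) simp
  have graphs: "pair_graph G" "pair_graph (attach_leaf G (x, y) w z)"
    using assms(1,2) by (auto simp: trivalent_tree_def undirected_tree_def)
  show ?thesis
  proof (rule tree_graph_arcI)
    show "unlabeled G \<in> tree_level i"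
      using assms(1,3) by (rule unlabeled_in_tree_level)
    show "unlabeled (attach_leaf G (x, y) w z) \<in> tree_level (i + 1)"
      using assms(2,4) by (rule unlabeled_in_tree_level)
    show "relabel ?f G \<in> unlabeled G"
      using graphs(1) inj by (rule relabel_in_unlabeled)
    show "attach_leaf (relabel ?f G) (?f x, ?f y) (?f w) (?f z)
        \<in> unlabeled (attach_leaf G (x, y) w z)"
      using relabel_in_unlabeled[OF graphs(2) inj]
      by (simp only: relabel_attach_leaf[OF inj_node_code])
    show "(?f x, ?f y) \<in> parcs (relabel ?f G)"
      using imageI[OF assms(6), of "map_prod ?f ?f"] by simp
    show "?f w \<notin> pverts (relabel ?f G)" "?f z \<notin> pverts (relabel ?f G)" "?f w \<noteq> ?f z"
      using assms(7-9) by (simp_all add: inj_image_mem_iff[OF inj_node_code] inj_eq[OF inj_node_code])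
  qed fact
qed

section \<open>Tree sequences\<close>

lemma trivalent_tree_labeled_T3: "trivalent_tree labeled_T3"
  and leaves_labeled_T3: "leaves labeled_T3 = Leaf ` {1..3}"
proof -
  have G: "pair_graph labeled_T3"
    unfolding pair_graph_iff by (auto simp: labeled_T3_def sym_def)
  have deg3: "out_degree (with_proj labeled_T3) (Internal 3) = 3"
  proof -
    have "parcs labeled_T3 `` {Internal 3} = {Leaf 1, Leaf 2, Leaf 3}"
      by (auto simp: labeled_T3_def)
    then show ?thesis by (simp add: out_degree_eq_card_Image)
  qed
  have deg1: "out_degree (with_proj labeled_T3) (Leaf k) = 1" if "k \<in> {1, 2, 3}" for k
  proof -
    have "parcs labeled_T3 `` {Leaf k} = {Internal 3}"
      using that by (auto simp: labeled_T3_def)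
    then show ?thesis by (simp add: out_degree_eq_card_Image)
  qed
  have "{1..3 :: nat} = {1, 2, 3}"
    by auto
  then show leaves: "leaves labeled_T3 = Leaf ` {1..3}"
    using deg1 deg3 by (auto simp: leaves_def labeled_T3_def)
  have centre: "(Internal 3, v) \<in> (parcs labeled_T3)\<^sup>*" "(v, Internal 3) \<in> (parcs labeled_T3)\<^sup>*"
    if "v \<in> pverts labeled_T3" for v
    using that by (auto simp: labeled_T3_def)
  then have "Digraph_Component.connected (with_proj labeled_T3)"
    unfolding connected_iff_rtrancl[OF G]
  proof (intro conjI ballI)
    show "pverts labeled_T3 \<noteq> {}"
      by (simp add: labeled_T3_def)
  qed (rule rtrancl_trans[OF centre(2) centre(1)])
  moreover have False
    if p: "pre_digraph.cycle (with_proj labeled_T3) p" "3 \<le> length p" for p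
  proof -
    define V where "V = fst ` set p"
    note off_cycle = single_neighbour_not_on_cycle[OF G p, folded V_def]
    have leaf: "Leaf k \<notin> V" for k
      by (rule off_cycle[where c = "Internal 3"]) (auto simp: labeled_T3_def)
    have "Internal 3 \<notin> V"
      by (rule off_cycle) (use leaf in \<open>auto simp: labeled_T3_def\<close>)
    moreover have "hd p \<in> set p"
      using p(2) by (intro hd_in_set) auto
    then have "fst (hd p) \<in> V" "hd p \<in> parcs labeled_T3"
      using p(1) by (auto simp: cycle_iff_pcas[OF G] V_def)
    moreover from this(2) have "fst (hd p) = Internal 3 \<or> (\<exists>k. fst (hd p) = Leaf k)"
      by (auto simp: labeled_T3_def)
    ultimately show False
      using leaf by metis
  qed
  ultimately show "trivalent_tree labeled_T3"
    using G leaves deg3 \<open>{1..3 :: nat} = {1, 2, 3}\<close>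
    by (auto simp: trivalent_tree_def undirected_tree_def labeled_T3_def)
qed

text \<open>The isomorphism sends the centre to \<open>0\<close> and the leaf labeled \<open>k\<close> to \<open>k\<close>.\<close>

lemma T3_eq_unlabeled: "T3 = unlabeled labeled_T3"
proof -
  define f where "f v = (case v of Leaf k \<Rightarrow> k | Internal _ \<Rightarrow> 0)" for v :: node
  have "inj_on f (pverts labeled_T3)"
    by (auto simp: f_def labeled_T3_def)
  moreover have "pair_graph labeled_T3"
    using trivalent_tree_labeled_T3 by (simp add: trivalent_tree_def undirected_tree_def)
  ultimately have "unlabeled labeled_T3 = unlabeled (relabel f labeled_T3)"
    by (simp add: unlabeled_relabel)
  also have "relabel f labeled_T3 = \<lparr>pverts = {0, 1, 2, 3},
       parcs = {(0, 1), (1, 0), (0, 2), (2, 0), (0, 3), (3, 0)}\<rparr>"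
    by (simp add: relabel_def labeled_T3_def f_def insert_commute)
  finally show ?thesis
    by (simp add: T3_def)
qed

lemma replace_by_cherry_eq_attach_leaf:
  assumes "(x, Leaf i) \<in> parcs G" "\<And>x'. (x', Leaf i) \<in> parcs G \<Longrightarrow> x' = x"
  shows "replace_by_cherry G i l = attach_leaf G (x, Leaf i) (Internal l) (Leaf l)"
proof -
  have "(THE x. (x, Leaf i) \<in> parcs G) = x"
    using assms by blast
  then show ?thesis
    by (auto simp: replace_by_cherry_def Let_def attach_leaf_def)
qed

lemma nth_concat_pairs:
  "k < length xs \<Longrightarrow> concat (map (\<lambda>x. [f x, g x]) xs) ! (2 * k) = f (xs ! k)"
  by (induction xs arbitrary: k) (auto simp: nth_Cons split: nat.split)

text \<open>
  The entry at position \<open>2 * (n - l)\<close> is the first root of the pair for \<open>l\<close>, and the map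
  $a \mapsto \varepsilon_a - \varepsilon_l$ is injective; so the definite description in
  \<open>seq_index\<close> picks the index $i_l$ with which the sequence was built.
\<close>

lemma seq_index_in_range:
  assumes "iterated_sequence n S" "3 \<le> l" "l \<le> n"
  shows "seq_index n S l \<in> {1..l - 1}"
proof -
  obtain i j where "\<forall>l \<in> {3..n}. i l \<in> {1..l - 1}"
    and S: "S = concat (map (\<lambda>l. [eps (i l) - eps l, eps (j l) - eps l]) (rev [3..<Suc n]))"
    using assms(1) unfolding iterated_sequence_def by blast
  then have i: "i l \<in> {1..l - 1}"
    using assms(2,3) by simp
  have "S ! (2 * (n - l)) = eps (i l) - eps l"
    unfolding S by (subst nth_concat_pairs) (use assms in \<open>auto simp: rev_nth simp del: upt_Suc\<close>)
  moreover have "eps a - eps l = eps b - eps l \<longleftrightarrow> a = b" for a b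
  proof
    assume "eps a - eps l = eps b - eps l"
    then have "eps a a = eps b a"
      by (auto simp: fun_eq_iff)
    then show "a = b"
      by (simp add: eps_def split: if_splits)
  qed simp
  ultimately have "seq_index n S l = i l"
    using i unfolding seq_index_def by (intro the_equality) auto
  with i show ?thesis
    by simp
qed

text \<open>
  The invariant of the tree sequence. The bound on the vertices guarantees that \<open>Leaf (l + 1)\<close> and
  \<open>Internal (l + 1)\<close> are new in the next step.
\<close>

definition valid_labels :: "nat \<Rightarrow> node pair_pre_digraph \<Rightarrow> bool" where
  "valid_labels l G \<longleftrightarrow> trivalent_tree G \<and> leaves G = Leaf ` {1..l} \<and>
     pverts G \<subseteq> Leaf ` {1..l} \<union> Internal ` {3..l}"

lemma valid_labels_replace_by_cherry:
  assumes G: "valid_labels l G" and i: "i \<in> {1..l}" and l: "3 \<le> l"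
  shows "valid_labels (Suc l) (replace_by_cherry G i (Suc l))"
    and "(unlabeled G, unlabeled (replace_by_cherry G i (Suc l))) \<in> parcs tree_graph"
proof -
  have tree: "trivalent_tree G" and leaves: "leaves G = Leaf ` {1..l}"
    and verts: "pverts G \<subseteq> Leaf ` {1..l} \<union> Internal ` {3..l}"
    using G by (auto simp: valid_labels_def)
  have graph: "pair_graph G"
    using tree by (simp add: trivalent_tree_def undirected_tree_def)
  have "Leaf i \<in> leaves G"
    using leaves i by blast
  then obtain x where x: "parcs G `` {Leaf i} = {x}"
    by (auto simp: leaves_def out_degree_eq_card_Image card_1_singleton_iff)
  interpret leaf_edge_attachment G x "Leaf i" "Internal (Suc l)" "Leaf (Suc l)"
    by unfold_locales (use tree x verts in auto)
  have "x' = x" if "(x', Leaf i) \<in> parcs G" for x'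
    using pair_graph_arc_sym[OF graph that] x by blast
  then have G'_eq: "replace_by_cherry G i (Suc l) = G'"
    by (rule replace_by_cherry_eq_attach_leaf[OF xy(1)])
  have leaves': "leaves G' = Leaf ` {1..Suc l}"
    by (simp add: leaves_attach leaves atLeastAtMostSuc_conv)
  have "{1..Suc l} = insert (Suc l) {1..l}" "{3..Suc l} = insert (Suc l) {3..l}"
    using l by auto
  with verts have "pverts G' \<subseteq> Leaf ` {1..Suc l} \<union> Internal ` {3..Suc l}"
    by (simp only: attach_leaf_simps image_insert) blast
  then show "valid_labels (Suc l) (replace_by_cherry G i (Suc l))"
    using trivalent_tree_attach leaves' unfolding G'_eq valid_labels_def by (intro conjI)
  have card: "card (Leaf ` A) = card A" for A
    by (simp add: card_image inj_on_def)
  show "(unlabeled G, unlabeled (replace_by_cherry G i (Suc l))) \<in> parcs tree_graph"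
    unfolding G'_eq
    by (rule attach_leaf_tree_graph_arc[OF tree trivalent_tree_attach])
      (use l leaves leaves' new xy in \<open>simp_all add: card\<close>)
qed

lemma valid_labels_labeled_tree:
  assumes "iterated_sequence n S" "3 \<le> l" "l \<le> n"
  shows "valid_labels l (labeled_tree n S l)"
  using assms(2,3)
proof (induction l rule: dec_induct)
  case base
  then show ?case
    using trivalent_tree_labeled_T3 leaves_labeled_T3
    by (auto simp: valid_labels_def labeled_tree.simps[of n S 3] labeled_T3_def)
next
  case (step l)
  then show ?case
    using seq_index_in_range[OF assms(1), of "Suc l"]
    by (simp add: labeled_tree.simps[of n S "Suc l"] valid_labels_replace_by_cherry)
qed

lemma labeled_tree_tree_graph_arc:
  assumes "iterated_sequence n S" "3 \<le> l" "l < n"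
  shows "(unlabeled (labeled_tree n S l), unlabeled (labeled_tree n S (Suc l))) \<in> parcs tree_graph"
  using valid_labels_labeled_tree[OF assms(1), of l] seq_index_in_range[OF assms(1), of "Suc l"] assms
  by (simp add: labeled_tree.simps[of n S "Suc l"] valid_labels_replace_by_cherry)

lemma unlabeled_labeled_tree_in_tree_level:
  assumes "iterated_sequence n S" "3 \<le> l" "l \<le> n"
  shows "unlabeled (labeled_tree n S l) \<in> tree_level l"
  using valid_labels_labeled_tree[OF assms]
  by (intro unlabeled_in_tree_level) (auto simp: valid_labels_def card_image inj_on_def)

text \<open>The arcs of a vertex walk that is listed by an index interval join consecutive indices.\<close>

lemma set_vwalk_arcs_map_upt:
  "set (vwalk_arcs (map f [m..<n])) = (\<lambda>k. (f k, f (Suc k))) ` {m..<n - 1}"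
proof (induction n)
  case (Suc n)
  show ?case
  proof (cases "m < n")
    case True
    then have "{m..<n} = insert (n - 1) {m..<n - 1}"
      by auto
    with True Suc show ?thesis
      by (simp add: set_vwalk_arcs_snoc last_map)
  qed auto
qed simp

theorem corollary4:
  fixes n :: nat and S :: "(nat \<Rightarrow> real) list"
  assumes "n \<ge> 3"
    and "iterated_sequence n S"
  shows "let P = map (\<lambda>l. unlabeled (labeled_tree n S l)) [3..<Suc n] in
    vpath P (with_proj tree_graph) \<and> hd P = T3 \<and> last P = unlabeled (labeled_tree n S n)"
proof -
  define U where "U l = unlabeled (labeled_tree n S l)" for l
  let ?P = "map U [3..<Suc n]"
  have level: "U l \<in> tree_level l" if "l \<in> {3..n}" for l
    using unlabeled_labeled_tree_in_tree_level[OF assms(2)] that by (simp add: U_def)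
  have "vwalk ?P (with_proj tree_graph)"
  proof
    show "set ?P \<subseteq> verts (with_proj tree_graph)"
      using level by (fastforce simp: tree_graph_def simp del: upt_Suc)
    show "set (vwalk_arcs ?P) \<subseteq> arcs_ends (with_proj tree_graph)"
      unfolding set_vwalk_arcs_map_upt
      using labeled_tree_tree_graph_arc[OF assms(2)] by (auto simp: U_def)
    show "?P \<noteq> []"
      using assms(1) by simp
  qed
  moreover have "distinct ?P"
  proof -
    have "inj_on U {3..n}"
      using level tree_level_unique by (metis inj_onI)
    moreover have "set [3..<Suc n] = {3..n}"
      by auto
    ultimately show ?thesis
      by (simp add: distinct_map del: upt_Suc)
  qed
  moreover have "hd ?P = T3"
    using assms(1) by (simp add: hd_map U_def T3_eq_unlabeled labeled_tree.simps[of n S 3] del: upt_Suc)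
  moreover have "last ?P = U n"
    using assms(1) by simp
  ultimately show ?thesis
    by (simp only: U_def[abs_def] Let_def vpath_def simp_thms)
qed

end
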